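(* Let $L>0$, $\alpha>0$, $\beta\in(0,1)$, let $x^*\in C^1([0,L],\mathbb R^n)$, and let $Q\in\mathbb R^{n\times n}$ be positive definite with $Q\ge\delta I$ for some $\delta>0$. Let $\lambda>0$ and $\rho\in(0,1)$ be such that $\|T_k(x)-T_k(y)\|_\lambda\le\rho\|x-y\|_\lambda$ for all $x,y\in\mathcal X$ and all $k\ge1$. Suppose $D_2\ge\max\{D_0,D^*\}$, where $$D_0=\|y_1\|_\lambda,\qquad D^*=\frac{\beta\rho}{(1-\beta)(1-\rho)}\|x^*\|_\lambda,$$ and let $S=\{y\in\mathcal X:\|y\|_\lambda\le D_2\}$. Let $y_1$ be the solution on $[0,L]$ of $y_1(t)=-x^*(t)-\Gamma_1\int_0^t y_1(s)\,ds$, and for $k\ge2$ let $$y_k=T_k(y_{k-1})+T_k\!\left(-\frac{\beta}{1-\beta}x^*\right).$$ Then there exists a unique limit solution as $k\to\infty$: there is a unique $y_\infty\in S$ satisfying $$y_\infty=T_\infty\!\left(y_\infty-\frac{\beta}{1-\beta}x^*\right),$$ and $\lim_{k\to\infty}y_k=y_\infty$ in $\|\cdot\|_\lambda$.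
   Context: $\mathcal X=C([0,L],\mathbb R^n)$ with the $\lambda$-norm $\|f\|_\lambda=\max_{t\in[0,L]}e^{-\lambda t}\|f(t)\|_\infty$, where $\|\cdot\|_\infty$ is the max norm on $\mathbb R^n$. For $k\ge1$, $$\gamma_k=\frac{1-(1-\beta)^k}{\beta},\qquad \Gamma_k=\frac{\alpha\gamma_kQ}{2},\qquad \Gamma_\infty=\frac{\alpha Q}{2\beta},$$ and for $x\in\mathcal X$, $$T_k(x)(t)=(1-\beta)x(t)-(1-\beta)e^{-\Gamma_kt}\int_0^te^{\Gamma_ks}\Gamma_kx(s)\,ds,$$ while $T_\infty$ is given by the same formula with $\Gamma_\infty$ in place of $\Gamma_k$. (Here $y_k=z_k-x^*$ is the tracking error of the iterative learning control law $z_k=(1-\beta)z_{k-1}-\Gamma_k\int_0^t(z_k-x^* )ds$, $z_0=0$.) *)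

theory Defs
  imports "HOL-Analysis.Analysis"
begin

text \<open>
  Multiplication and powers on \<open>real^'n^'n\<close> are componentwise in the library, so powers
  with respect to \<open>(**)\<close> have to be written out.
\<close>

definition mat_exp :: "real^'n^'n \<Rightarrow> real^'n^'n" where
  "mat_exp A = (\<Sum>k. (1 / fact k) *\<^sub>R (((**) A ^^ k) (mat 1)))"

text \<open>Symmetry is not part of either notion; symmetric matrices are a special case.\<close>

definition positive_definite :: "real^'n^'n \<Rightarrow> bool" where
  "positive_definite A \<longleftrightarrow> (\<forall>v. v \<noteq> 0 \<longrightarrow> v \<bullet> (A *v v) > 0)"

definition positive_semidefinite :: "real^'n^'n \<Rightarrow> bool" where
  "positive_semidefinite A \<longleftrightarrow> (\<forall>v. v \<bullet> (A *v v) \<ge> 0)"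

text \<open>\<open>A \<ge> B\<close> for matrices (the order \<open>\<le>\<close> of the library is componentwise)\<close>

definition loewner_ge :: "real^'n^'n \<Rightarrow> real^'n^'n \<Rightarrow> bool" where
  "loewner_ge A B \<longleftrightarrow> positive_semidefinite (A - B)"

text \<open>One-sided derivatives at the end points, unlike \<open>C1_differentiable_on\<close>.\<close>

definition C1_on_interval :: "real \<Rightarrow> (real \<Rightarrow> real^'n) \<Rightarrow> bool" where
  "C1_on_interval L f \<longleftrightarrow>
     (\<exists>f'. continuous_on {0..L} f' \<and>
           (\<forall>t\<in>{0..L}. (f has_vector_derivative f' t) (at t within {0..L})))"

text \<open>
  \<open>C([0,L], \<real>\<^sup>n)\<close>. Requiring the functions to be \<open>undefined\<close> outside \<open>[0,L]\<close> makes equality of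
  elements coincide with equality on \<open>[0,L]\<close>. The operators below only look at the values of
  their arguments on \<open>[0,L]\<close>, so arguments themselves need not be restricted.
\<close>

definition Cspace :: "real \<Rightarrow> (real \<Rightarrow> real^'n) set" where
  "Cspace L = {f. continuous_on {0..L} f \<and> f \<in> extensional {0..L}}"

text \<open>
  \<open>infnorm\<close> is the max norm on \<open>\<real>\<^sup>n\<close>; for continuous \<open>f\<close> the supremum is attained.
\<close>

definition lambda_norm :: "real \<Rightarrow> real \<Rightarrow> (real \<Rightarrow> real^'n) \<Rightarrow> real" where
  "lambda_norm L lam f = (SUP t\<in>{0..L}. exp (- lam * t) * infnorm (f t))"

definition gain_coeff :: "real \<Rightarrow> nat \<Rightarrow> real" where
  "gain_coeff \<beta> k = (1 - (1 - \<beta>) ^ k) / \<beta>"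

definition gain :: "real \<Rightarrow> real \<Rightarrow> real^'n^'n \<Rightarrow> nat \<Rightarrow> real^'n^'n" where
  "gain \<alpha> \<beta> Q k = (\<alpha> * gain_coeff \<beta> k / 2) *\<^sub>R Q"

definition gain_inf :: "real \<Rightarrow> real \<Rightarrow> real^'n^'n \<Rightarrow> real^'n^'n" where
  "gain_inf \<alpha> \<beta> Q = (\<alpha> / (2 * \<beta>)) *\<^sub>R Q"

text \<open>The common form of \<open>T\<^sub>k\<close> and \<open>T\<^sub>\<infinity>\<close>, with the gain matrix \<open>G\<close> as a parameter.\<close>

definition T_gain ::
  "real \<Rightarrow> real \<Rightarrow> real^'n^'n \<Rightarrow> (real \<Rightarrow> real^'n) \<Rightarrow> real \<Rightarrow> real^'n" where
  "T_gain L \<beta> G x = (\<lambda>t\<in>{0..L}.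
     (1 - \<beta>) *\<^sub>R x t
     - (1 - \<beta>) *\<^sub>R (mat_exp (- (t *\<^sub>R G)) *v
         integral {0..t} (\<lambda>s. (mat_exp (s *\<^sub>R G) ** G) *v x s)))"

definition T ::
  "real \<Rightarrow> real \<Rightarrow> real \<Rightarrow> real^'n^'n \<Rightarrow> nat \<Rightarrow> (real \<Rightarrow> real^'n) \<Rightarrow> real \<Rightarrow> real^'n" where
  "T L \<alpha> \<beta> Q k = T_gain L \<beta> (gain \<alpha> \<beta> Q k)"

definition T_inf ::
  "real \<Rightarrow> real \<Rightarrow> real \<Rightarrow> real^'n^'n \<Rightarrow> (real \<Rightarrow> real^'n) \<Rightarrow> real \<Rightarrow> real^'n" where
  "T_inf L \<alpha> \<beta> Q = T_gain L \<beta> (gain_inf \<alpha> \<beta> Q)"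

end

theory Submission
  imports Defs
begin

text \<open>
  Write \<open>b = \<beta> / (1 - \<beta>)\<close>. Since \<open>T\<^sub>k\<close> is additive, the recursion reads
  \<open>y\<^sub>k = T\<^sub>k (y\<^sub>k\<^sub>-\<^sub>1 - b x\<^sup>*)\<close>, a fixed point iteration whose map varies with \<open>k\<close>. The gains
  \<open>\<Gamma>\<^sub>k\<close> converge to \<open>\<Gamma>\<^sub>\<infinity>\<close> and the kernel of the operator depends continuously on its gain
  matrix, so \<open>T\<^sub>k u \<rightarrow> T\<^sub>\<infinity> u\<close> uniformly on \<open>[0,L]\<close> for each fixed continuous \<open>u\<close>
  (\<open>uniform_limit_T_gain\<close>); hence \<open>T\<^sub>\<infinity>\<close> inherits the contraction constant \<open>\<rho>\<close>, which does not
  depend on \<open>k\<close>. Banach's theorem (\<open>lambda_contraction_fixed_point\<close>) then yields a fixed point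
  \<open>z\<close> of \<open>u \<mapsto> T\<^sub>\<infinity> (u - b x\<^sup>*)\<close>, unique in all of \<open>C([0,L])\<close>. It is found without reference
  to \<open>S\<close>, and lies in \<open>S\<close> by an a posteriori bound.

  For convergence let \<open>\<epsilon>\<^sub>k = \<parallel>T\<^sub>k (z - b x\<^sup>*) - T\<^sub>\<infinity> (z - b x\<^sup>*)\<parallel>\<close>, which tends to \<open>0\<close>. The triangle
  inequality through \<open>T\<^sub>k (z - b x\<^sup>*)\<close> gives
  \<open>\<parallel>y\<^sub>k - z\<parallel> \<le> \<rho> \<parallel>y\<^sub>k\<^sub>-\<^sub>1 - z\<parallel> + \<epsilon>\<^sub>k\<close>, and such a sequence tends to \<open>0\<close>
  (\<open>perturbed_contraction_tendsto_0\<close>).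
\<close>

section \<open>Continuity of the matrix exponential\<close>

lemma bounded_bilinear_matrix_mult:
  "bounded_bilinear ((**) :: real^'m^'n \<Rightarrow> real^'k^'m \<Rightarrow> real^'k^'n)"
  unfolding bilinear_conv_bounded_bilinear[symmetric] bilinear_def
  by (auto intro!: linearI
      simp: matrix_matrix_mult_def vec_eq_iff algebra_simps sum.distrib sum_distrib_left)

lemma bounded_bilinear_matrix_vector_mult:
  "bounded_bilinear ((*v) :: real^'m^'n \<Rightarrow> real^'m \<Rightarrow> real^'n)"
  unfolding bilinear_conv_bounded_bilinear[symmetric] bilinear_def
  by (auto intro!: linearI
      simp: matrix_vector_mult_def vec_eq_iff algebra_simps sum.distrib sum_distrib_left)

lemmas continuous_on_matrix_mult [continuous_intros] =
  bounded_bilinear.continuous_on[OF bounded_bilinear_matrix_mult]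

lemmas continuous_on_matrix_vector_mult [continuous_intros] =
  bounded_bilinear.continuous_on[OF bounded_bilinear_matrix_vector_mult]

text \<open>The exponential series is dominated on bounded sets by a scalar exponential series,
  hence converges uniformly there.\<close>

lemma continuous_on_mat_exp: "continuous_on A (mat_exp :: real^'n^'n \<Rightarrow> real^'n^'n)"
proof -
  obtain K :: real where K: "K > 0"
    and mult_le: "\<And>(A :: real^'n^'n) (B :: real^'n^'n). norm (A ** B) \<le> norm A * norm B * K"
    using bounded_bilinear.pos_bounded[OF bounded_bilinear_matrix_mult] by blast
  have pow_le: "norm (((**) A ^^ k) (mat 1)) \<le> (M * K) ^ k * norm (mat 1 :: real^'n^'n)"
    if "norm A \<le> M" for A :: "real^'n^'n" and M k
  proof (induction k)
    case (Suc k)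
    have "0 \<le> M"
      using that norm_ge_zero order_trans by blast
    have "norm (((**) A ^^ Suc k) (mat 1)) \<le> norm A * norm (((**) A ^^ k) (mat 1)) * K"
      using mult_le by simp
    also have "\<dots> \<le> M * ((M * K) ^ k * norm (mat 1 :: real^'n^'n)) * K"
      using that Suc K \<open>0 \<le> M\<close> by (intro mult_right_mono mult_mono) auto
    finally show ?case
      by (simp add: algebra_simps)
  qed simp
  have cont_pow: "continuous_on B (\<lambda>A :: real^'n^'n. ((**) A ^^ k) (mat 1))" for B k
    by (induction k) (auto intro!: continuous_intros)
  have on_ball: "continuous_on (cball 0 M) (mat_exp :: real^'n^'n \<Rightarrow> real^'n^'n)" for M
  proof (rule uniform_limit_theorem)
    show "\<forall>\<^sub>F m in sequentially. continuous_on (cball 0 M)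
        (\<lambda>A :: real^'n^'n. \<Sum>k<m. (1 / fact k) *\<^sub>R ((**) A ^^ k) (mat 1))"
      by (intro always_eventually allI continuous_intros cont_pow)
    show "uniform_limit (cball 0 M)
        (\<lambda>m (A :: real^'n^'n). \<Sum>k<m. (1 / fact k) *\<^sub>R ((**) A ^^ k) (mat 1))
        mat_exp sequentially"
      unfolding mat_exp_def
    proof (rule Weierstrass_m_test)
      fix k and A :: "real^'n^'n"
      assume "A \<in> cball 0 M"
      then show "norm ((1 / fact k) *\<^sub>R ((**) A ^^ k) (mat 1))
          \<le> (M * K) ^ k / fact k * norm (mat 1 :: real^'n^'n)"
        using pow_le[of A M k] by (simp add: divide_right_mono)
    next
      show "summable (\<lambda>k. (M * K) ^ k / fact k * norm (mat 1 :: real^'n^'n))"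
        using summable_exp[of "M * K"] by (intro summable_mult2) (simp add: field_simps)
    qed
  qed simp
  have "isCont mat_exp A" for A :: "real^'n^'n"
  proof (rule continuous_on_interior[OF on_ball])
    show "A \<in> interior (cball 0 (norm A + 1))"
      by (simp add: interior_cball)
  qed
  then show ?thesis
    by (simp add: continuous_at_imp_continuous_on)
qed

lemma continuous_on_mat_exp_compose [continuous_intros]:
  fixes f :: "_ \<Rightarrow> real^'n^'n"
  assumes "continuous_on A f"
  shows "continuous_on A (\<lambda>x. mat_exp (f x))"
  using continuous_on_compose2[OF continuous_on_mat_exp[of UNIV] assms] by simp

section \<open>Uniform convergence of the operators\<close>

text \<open>Joint continuity becomes uniform convergence by uniform continuity on a compact
  neighbourhood of the limit parameter.\<close>

lemma uniform_limit_jointly_continuous: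
  fixes h :: "'p :: heine_borel \<Rightarrow> 't :: metric_space \<Rightarrow> 'b :: metric_space"
  assumes h: "continuous_on (UNIV \<times> X) (\<lambda>(p, t). h p t)" and X: "compact X"
    and p: "p \<longlonglongrightarrow> p'"
  shows "uniform_limit X (\<lambda>n t. h (p n) t) (h p') sequentially"
proof -
  have ucont: "uniformly_continuous_on (cball p' 1 \<times> X) (\<lambda>(p, t). h p t)"
    using h X by (intro compact_uniformly_continuous compact_Times)
      (auto intro: continuous_on_subset)
  have lim: "uniform_limit X (\<lambda>n t. (p n, t)) (\<lambda>t. (p', t)) sequentially"
  proof (rule uniform_limitI)
    fix e :: real
    assume "e > 0"
    then show "\<forall>\<^sub>F n in sequentially. \<forall>t\<in>X. dist (p n, t) (p', t) < e"
      using tendstoD[OF p] by (simp add: dist_Pair_Pair)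
  qed
  have near: "\<forall>\<^sub>F n in sequentially. (\<lambda>t. (p n, t)) ` X \<subseteq> cball p' 1 \<times> X"
    using tendstoD[OF p zero_less_one] by eventually_elim (auto simp: dist_commute)
  show ?thesis
    using uniform_limit_compose[OF lim ucont near] by (auto simp: o_def image_subset_iff)
qed

lemma uniform_limit_indefinite_integral:
  fixes f :: "nat \<Rightarrow> real \<Rightarrow> 'b :: banach"
  assumes lim: "uniform_limit {0..L} f g sequentially"
    and f: "\<And>n. continuous_on {0..L} (f n)"
  shows "uniform_limit {0..L} (\<lambda>n t. integral {0..t} (f n)) (\<lambda>t. integral {0..t} g) sequentially"
proof (rule uniform_limitI)
  fix e :: real
  assume "e > 0"
  define d where "d = e / 2 / (\<bar>L\<bar> + 1)"
  have "d > 0"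
    using \<open>e > 0\<close> by (simp add: d_def)
  have g: "continuous_on {0..L} g"
    using uniform_limit_theorem[OF _ lim] f by simp
  show "\<forall>\<^sub>F n in sequentially.
      \<forall>t\<in>{0..L}. dist (integral {0..t} (f n)) (integral {0..t} g) < e"
    using uniform_limitD[OF lim \<open>d > 0\<close>]
  proof eventually_elim
    case (elim n)
    show ?case
    proof
      fix t
      assume t: "t \<in> {0..L}"
      then have cont: "continuous_on {0..t} (f n)" "continuous_on {0..t} g"
        by (auto intro: continuous_on_subset[OF f] continuous_on_subset[OF g])
      have "dist (integral {0..t} (f n)) (integral {0..t} g)
          = norm (integral {0..t} (\<lambda>s. f n s - g s))"
        using cont by (simp add: dist_norm integral_diff integrable_continuous_interval)
      also have "\<dots> \<le> d * (t - 0)"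
        using t elim cont
        by (intro integral_bound continuous_on_diff) (auto simp: dist_norm intro!: less_imp_le)
      also have "\<dots> \<le> d * (\<bar>L\<bar> + 1)"
        using t \<open>d > 0\<close> by (intro mult_left_mono) auto
      also have "\<dots> = e / 2"
        unfolding d_def by (rule nonzero_eq_divide_eq[THEN iffD1, OF _ refl]) linarith
      also have "\<dots> < e"
        using \<open>e > 0\<close> by simp
      finally show "dist (integral {0..t} (f n)) (integral {0..t} g) < e" .
    qed
  qed
qed

lemma continuous_on_T_gain_integrand:
  fixes x :: "real \<Rightarrow> real^'n"
  assumes "continuous_on {0..L} x"
  shows "continuous_on (UNIV \<times> {0..L}) (\<lambda>(G, s). (mat_exp (s *\<^sub>R G) ** G) *v x s)"
  using assms unfolding split_beta
  by (auto intro!: continuous_intros intro: continuous_on_compose2)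

lemma continuous_on_T_gain_integrand_fixed:
  fixes x :: "real \<Rightarrow> real^'n"
  assumes "continuous_on {0..L} x"
  shows "continuous_on {0..L} (\<lambda>s. (mat_exp (s *\<^sub>R G) ** G) *v x s)"
  using assms by (intro continuous_intros)

lemma continuous_on_T_gain_integral:
  fixes x :: "real \<Rightarrow> real^'n"
  assumes "continuous_on {0..L} x"
  shows "continuous_on {0..L} (\<lambda>t. integral {0..t} (\<lambda>s. (mat_exp (s *\<^sub>R G) ** G) *v x s))"
  by (intro indefinite_integral_continuous_1 integrable_continuous_interval
      continuous_on_T_gain_integrand_fixed assms)

lemma restrict_in_Cspace:
  assumes "continuous_on {0..L} x"
  shows "restrict x {0..L} \<in> Cspace L"
proof -
  have "continuous_on {0..L} (restrict x {0..L}) \<longleftrightarrow> continuous_on {0..L} x"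
    by (rule continuous_on_cong) simp_all
  with assms show ?thesis
    by (simp add: Cspace_def)
qed

lemma T_gain_in_Cspace:
  assumes "continuous_on {0..L} x"
  shows "T_gain L \<beta> G x \<in> Cspace L"
  unfolding T_gain_def
  by (intro restrict_in_Cspace continuous_intros continuous_on_T_gain_integral assms)

lemma T_gain_cong:
  assumes "\<And>t. t \<in> {0..L} \<Longrightarrow> x t = z t"
  shows "T_gain L \<beta> G x = T_gain L \<beta> G z"
  unfolding T_gain_def
  by (intro restrict_ext arg_cong2[of _ _ _ _ "(-)"] arg_cong2[of _ _ _ _ "(*v)"]
      arg_cong2[of _ _ _ _ "(*\<^sub>R)"] integral_cong refl) (auto simp: assms)

lemma T_gain_zero: "t \<in> {0..L} \<Longrightarrow> T_gain L \<beta> G (\<lambda>s. 0) t = 0"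
  by (simp add: T_gain_def)

lemma T_gain_add:
  assumes "continuous_on {0..L} x" "continuous_on {0..L} z" and t: "t \<in> {0..L}"
  shows "T_gain L \<beta> G (\<lambda>s. x s + z s) t = T_gain L \<beta> G x t + T_gain L \<beta> G z t"
proof -
  have "(\<lambda>s. (mat_exp (s *\<^sub>R G) ** G) *v u s) integrable_on {0..t}"
    if "continuous_on {0..L} u" for u
    using t by (intro integrable_continuous_interval
        continuous_on_subset[OF continuous_on_T_gain_integrand_fixed[OF that]]) auto
  from this[OF assms(1)] this[OF assms(2)] show ?thesis
    using t by (simp add: T_gain_def matrix_vector_right_distrib integral_add algebra_simps)
qed

text \<open>The integrand and the outer exponential converge uniformly because both are jointly
  continuous in the gain and the time; integration and multiplication of bounded functions
  preserve uniform limits.\<close>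

lemma uniform_limit_T_gain:
  fixes G :: "nat \<Rightarrow> real^'n^'n"
  assumes G: "G \<longlonglongrightarrow> G'" and x: "continuous_on {0..L} x"
  shows "uniform_limit {0..L} (\<lambda>k. T_gain L \<beta> (G k) x) (T_gain L \<beta> G' x) sequentially"
proof -
  have int: "uniform_limit {0..L} (\<lambda>k t. integral {0..t} (\<lambda>s. (mat_exp (s *\<^sub>R G k) ** G k) *v x s))
      (\<lambda>t. integral {0..t} (\<lambda>s. (mat_exp (s *\<^sub>R G') ** G') *v x s)) sequentially"
    by (intro uniform_limit_indefinite_integral continuous_on_T_gain_integrand_fixed x
        uniform_limit_jointly_continuous[where h = "\<lambda>G s. (mat_exp (s *\<^sub>R G) ** G) *v x s"]
        continuous_on_T_gain_integrand compact_Icc G)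
  have exp: "uniform_limit {0..L} (\<lambda>k t. mat_exp (- (t *\<^sub>R G k)))
      (\<lambda>t. mat_exp (- (t *\<^sub>R G'))) sequentially"
    by (rule uniform_limit_jointly_continuous[OF _ compact_Icc G])
      (auto simp: split_beta intro!: continuous_intros)
  have "uniform_limit {0..L}
      (\<lambda>k t. (1 - \<beta>) *\<^sub>R x t - (1 - \<beta>) *\<^sub>R (mat_exp (- (t *\<^sub>R G k)) *v
         integral {0..t} (\<lambda>s. (mat_exp (s *\<^sub>R G k) ** G k) *v x s)))
      (\<lambda>t. (1 - \<beta>) *\<^sub>R x t - (1 - \<beta>) *\<^sub>R (mat_exp (- (t *\<^sub>R G')) *v
         integral {0..t} (\<lambda>s. (mat_exp (s *\<^sub>R G') ** G') *v x s))) sequentially"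
    by (intro uniform_limit_intros int exp
        bounded_bilinear.bounded_uniform_limit[OF bounded_bilinear_matrix_vector_mult]
        bounded_linear.uniform_limit[OF bounded_linear_scaleR_right]
        compact_imp_bounded compact_continuous_image compact_Icc
        continuous_on_T_gain_integral x continuous_intros)
  then show ?thesis
    by (rule uniform_limit_cong'[THEN iffD1, rotated 2]) (auto simp: T_gain_def)
qed

section \<open>The weighted norm\<close>

lemma lambda_norm_cong:
  assumes "\<And>t. t \<in> {0..L} \<Longrightarrow> f t = g t"
  shows "lambda_norm L lam f = lambda_norm L lam g"
  unfolding lambda_norm_def using assms by (intro SUP_cong) auto

lemma weighted_infnorm_le_lambda_norm:
  assumes f: "continuous_on {0..L} f" and "t \<in> {0..L}"
  shows "exp (- lam * t) * infnorm (f t) \<le> lambda_norm L lam f"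
proof -
  have "continuous_on {0..L} (\<lambda>t. exp (- lam * t) * infnorm (f t))"
    using f by (auto simp: continuous_on_def intro!: tendsto_intros)
  then have "compact ((\<lambda>t. exp (- lam * t) * infnorm (f t)) ` {0..L})"
    by (intro compact_continuous_image compact_Icc)
  then show ?thesis
    unfolding lambda_norm_def using assms(2)
    by (intro cSUP_upper bounded_imp_bdd_above compact_imp_bounded)
qed

lemma lambda_norm_le:
  assumes "0 \<le> L" and "\<And>t. t \<in> {0..L} \<Longrightarrow> exp (- lam * t) * infnorm (f t) \<le> B"
  shows "lambda_norm L lam f \<le> B"
  unfolding lambda_norm_def using assms by (intro cSUP_least) auto

lemma lambda_norm_nonneg:
  assumes "0 \<le> L" "continuous_on {0..L} f"
  shows "0 \<le> lambda_norm L lam f"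
  using weighted_infnorm_le_lambda_norm[OF assms(2), of 0 lam] assms(1) infnorm_pos_le[of "f 0"]
  by simp

lemma lambda_norm_triangle:
  assumes L: "0 \<le> L" and f: "continuous_on {0..L} f" and g: "continuous_on {0..L} g"
  shows "lambda_norm L lam (\<lambda>t. f t + g t) \<le> lambda_norm L lam f + lambda_norm L lam g"
proof (rule lambda_norm_le[OF L])
  fix t
  assume t: "t \<in> {0..L}"
  have "exp (- lam * t) * infnorm (f t + g t)
      \<le> exp (- lam * t) * (infnorm (f t) + infnorm (g t))"
    by (intro mult_left_mono infnorm_triangle) simp
  also have "\<dots> \<le> lambda_norm L lam f + lambda_norm L lam g"
    using weighted_infnorm_le_lambda_norm[OF f t] weighted_infnorm_le_lambda_norm[OF g t]
    by (simp add: distrib_left add_mono)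
  finally show "exp (- lam * t) * infnorm (f t + g t) \<le> \<dots>" .
qed

lemma lambda_norm_diff_triangle:
  assumes "0 \<le> L" and "continuous_on {0..L} f" "continuous_on {0..L} g" "continuous_on {0..L} h"
  shows "lambda_norm L lam (\<lambda>t. f t - h t)
    \<le> lambda_norm L lam (\<lambda>t. f t - g t) + lambda_norm L lam (\<lambda>t. g t - h t)"
  using lambda_norm_triangle[of L "\<lambda>t. f t - g t" "\<lambda>t. g t - h t" lam] assms
  by (simp add: continuous_intros)

lemma lambda_norm_diff_commute:
  "lambda_norm L lam (\<lambda>t. f t - g t) = lambda_norm L lam (\<lambda>t. g t - f t)"
  unfolding lambda_norm_def by (subst infnorm_sub) (rule refl)

lemma lambda_norm_scaleR_le:
  assumes L: "0 \<le> L" and f: "continuous_on {0..L} f" and "0 \<le> c"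
  shows "lambda_norm L lam (\<lambda>t. c *\<^sub>R f t) \<le> c * lambda_norm L lam f"
proof (rule lambda_norm_le[OF L])
  fix t
  assume "t \<in> {0..L}"
  from mult_left_mono[OF weighted_infnorm_le_lambda_norm[OF f this, of lam] \<open>0 \<le> c\<close>]
  show "exp (- lam * t) * infnorm (c *\<^sub>R f t) \<le> c * lambda_norm L lam f"
    using \<open>0 \<le> c\<close> by (simp add: infnorm_mul algebra_simps)
qed

text \<open>The weight is at least \<open>exp (- lam * L)\<close> on \<open>[0,L]\<close> and the max norm is equivalent to the
  Euclidean one, so estimates in the weighted norm give uniform convergence.\<close>

lemma norm_le_lambda_norm:
  fixes f :: "real \<Rightarrow> real^'n"
  assumes f: "continuous_on {0..L} f" and t: "t \<in> {0..L}" and lam: "0 \<le> lam"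
  shows "norm (f t) \<le> sqrt DIM(real^'n) * exp (lam * L) * lambda_norm L lam f"
proof -
  have "infnorm (f t) = exp (lam * t) * (exp (- lam * t) * infnorm (f t))"
    by (simp add: exp_minus)
  also have "\<dots> \<le> exp (lam * L) * lambda_norm L lam f"
    using t lam weighted_infnorm_le_lambda_norm[OF f t] infnorm_pos_le[of "f t"]
    by (intro mult_mono) (auto intro: mult_left_mono)
  finally have "sqrt DIM(real^'n) * infnorm (f t)
      \<le> sqrt DIM(real^'n) * (exp (lam * L) * lambda_norm L lam f)"
    by (intro mult_left_mono) auto
  then show ?thesis
    using order_trans[OF norm_le_infnorm] by (simp only: mult.assoc)
qed

lemma lambda_norm_tendsto_0:
  fixes f :: "nat \<Rightarrow> real \<Rightarrow> real^'n"
  assumes lim: "uniform_limit {0..L} f g sequentially"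
    and L: "0 \<le> L" and lam: "0 \<le> lam"
    and f: "\<And>n. continuous_on {0..L} (f n)"
  shows "(\<lambda>n. lambda_norm L lam (\<lambda>t. f n t - g t)) \<longlonglongrightarrow> 0"
proof (rule tendstoI)
  fix e :: real
  assume "e > 0"
  have g: "continuous_on {0..L} g"
    using uniform_limit_theorem[OF _ lim] f by simp
  have "\<forall>\<^sub>F n in sequentially. \<forall>t\<in>{0..L}. dist (f n t) (g t) < e / 2"
    using uniform_limitD[OF lim, of "e / 2"] \<open>e > 0\<close> by simp
  then show "\<forall>\<^sub>F n in sequentially. dist (lambda_norm L lam (\<lambda>t. f n t - g t)) 0 < e"
  proof eventually_elim
    case (elim n)
    have "lambda_norm L lam (\<lambda>t. f n t - g t) \<le> e / 2"
    proof (rule lambda_norm_le[OF L])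
      fix t
      assume t: "t \<in> {0..L}"
      have "exp (- lam * t) * infnorm (f n t - g t) \<le> 1 * norm (f n t - g t)"
        using t lam by (intro mult_mono infnorm_le_norm) (auto simp: infnorm_pos_le)
      also have "\<dots> \<le> e / 2"
        using elim t by (simp add: dist_norm less_imp_le)
      finally show "exp (- lam * t) * infnorm (f n t - g t) \<le> e / 2" .
    qed
    moreover have "0 \<le> lambda_norm L lam (\<lambda>t. f n t - g t)"
      by (intro lambda_norm_nonneg L continuous_intros f g)
    ultimately show ?case
      using \<open>e > 0\<close> by simp
  qed
qed

lemma Cspace_eqI:
  fixes u v :: "real \<Rightarrow> real^'n"
  assumes "u \<in> Cspace L" "v \<in> Cspace L" "0 \<le> lam"
    and "lambda_norm L lam (\<lambda>t. u t - v t) \<le> 0"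
  shows "u = v"
proof (rule extensionalityI[of _ "{0..L}"])
  fix t
  assume t: "t \<in> {0..L}"
  have "norm (u t - v t)
      \<le> sqrt DIM(real^'n) * exp (lam * L) * lambda_norm L lam (\<lambda>t. u t - v t)"
    using assms t by (intro norm_le_lambda_norm) (auto simp: Cspace_def intro: continuous_intros)
  also have "\<dots> \<le> 0"
    using assms by (intro mult_nonneg_nonpos) auto
  finally show "u t = v t"
    by simp
qed (use assms in \<open>auto simp: Cspace_def\<close>)

section \<open>Contractions in the weighted norm\<close>

text \<open>Existence in Banach's fixed point theorem. The increments of the Picard iteration decay
  geometrically, so the telescoping series of increments converges uniformly by the M-test.\<close>

lemma lambda_contraction_fixed_point:
  fixes F :: "(real \<Rightarrow> real^'n) \<Rightarrow> real \<Rightarrow> real^'n"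
  assumes L: "0 \<le> L" and lam: "0 \<le> lam" and \<rho>: "0 \<le> \<rho>" "\<rho> < 1"
    and F: "\<And>u. u \<in> Cspace L \<Longrightarrow> F u \<in> Cspace L"
    and contr: "\<And>u v. \<lbrakk>u \<in> Cspace L; v \<in> Cspace L\<rbrakk> \<Longrightarrow>
      lambda_norm L lam (\<lambda>t. F u t - F v t) \<le> \<rho> * lambda_norm L lam (\<lambda>t. u t - v t)"
  shows "\<exists>z\<in>Cspace L. F z = z"
proof -
  define zero :: "real \<Rightarrow> real^'n" where "zero = restrict (\<lambda>t. 0) {0..L}"
  have zero: "zero \<in> Cspace L"
    unfolding zero_def by (intro restrict_in_Cspace continuous_intros)
  define u where "u n = (F ^^ n) (zero)" for n
  have u_Suc: "u (Suc n) = F (u n)" for n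
    by (simp add: u_def)
  have u: "u n \<in> Cspace L" for n
    by (induction n) (simp_all add: u_def F zero)
  then have u_cont: "continuous_on {0..L} (u n)" for n
    by (simp add: Cspace_def)
  define d where "d = lambda_norm L lam (\<lambda>t. u 1 t - u 0 t)"
  have decay: "lambda_norm L lam (\<lambda>t. u (Suc n) t - u n t) \<le> \<rho> ^ n * d" for n
  proof (induction n)
    case (Suc n)
    have "lambda_norm L lam (\<lambda>t. u (Suc (Suc n)) t - u (Suc n) t)
        \<le> \<rho> * lambda_norm L lam (\<lambda>t. u (Suc n) t - u n t)"
      using contr[OF u[of "Suc n"] u[of n]] by (simp only: u_Suc)
    also have "\<dots> \<le> \<rho> * (\<rho> ^ n * d)"
      using Suc \<rho> by (intro mult_left_mono)
    finally show ?case
      by simp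
  qed (simp add: d_def)
  define C where "C = sqrt DIM(real^'n) * exp (lam * L)"
  define w where "w t = u 0 t + (\<Sum>i. u (Suc i) t - u i t)" for t
  have "uniform_limit {0..L} (\<lambda>n t. \<Sum>i<n. u (Suc i) t - u i t)
      (\<lambda>t. \<Sum>i. u (Suc i) t - u i t) sequentially"
  proof (rule Weierstrass_m_test)
    fix n t
    assume "t \<in> {0..L}"
    then have "norm (u (Suc n) t - u n t)
        \<le> C * lambda_norm L lam (\<lambda>t. u (Suc n) t - u n t)"
      unfolding C_def by (intro norm_le_lambda_norm continuous_intros u_cont lam)
    also have "\<dots> \<le> C * (\<rho> ^ n * d)"
      using decay by (intro mult_left_mono) (auto simp: C_def)
    finally show "norm (u (Suc n) t - u n t) \<le> C * (\<rho> ^ n * d)" .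
  next
    show "summable (\<lambda>n. C * (\<rho> ^ n * d))"
      using \<rho> by (intro summable_mult summable_mult2 summable_geometric) simp
  qed
  from uniform_limit_add[OF uniform_limit_const[where c = "u 0"] this]
  have lim: "uniform_limit {0..L} u w sequentially"
    unfolding w_def
    by (simp add: sum_lessThan_telescope[of "\<lambda>n. u n t" for t, simplified])
  define z where "z = restrict w {0..L}"
  have lim_z: "uniform_limit {0..L} u z sequentially"
    using lim by (rule uniform_limit_cong'[THEN iffD1, rotated 2]) (auto simp: z_def)
  have z_cont: "continuous_on {0..L} z"
    using uniform_limit_theorem[OF _ lim_z] u_cont by simp
  then have z: "z \<in> Cspace L"
    by (simp add: Cspace_def z_def)
  have Fz_cont: "continuous_on {0..L} (F z)"
    using F[OF z] by (simp add: Cspace_def)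
  have to_z: "(\<lambda>n. lambda_norm L lam (\<lambda>t. u n t - z t)) \<longlonglongrightarrow> 0"
    by (rule lambda_norm_tendsto_0[OF lim_z L lam u_cont])
  have "lambda_norm L lam (\<lambda>t. F z t - z t)
      \<le> \<rho> * lambda_norm L lam (\<lambda>t. u n t - z t) + lambda_norm L lam (\<lambda>t. u (Suc n) t - z t)"
    for n
    using lambda_norm_diff_triangle[OF L Fz_cont u_cont z_cont, of lam "Suc n"] contr[OF z u, of n]
    by (simp add: u_Suc lambda_norm_diff_commute[of L lam z])
  moreover have "(\<lambda>n. \<rho> * lambda_norm L lam (\<lambda>t. u n t - z t)
      + lambda_norm L lam (\<lambda>t. u (Suc n) t - z t)) \<longlonglongrightarrow> \<rho> * 0 + 0"
    by (intro tendsto_intros to_z LIMSEQ_Suc)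
  ultimately have "lambda_norm L lam (\<lambda>t. F z t - z t) \<le> 0"
    by (intro LIMSEQ_le_const[of _ 0]) auto
  from Cspace_eqI[OF F[OF z] z lam this] z show ?thesis
    by blast
qed

text \<open>Once \<open>\<epsilon>\<close> stays below \<open>(1 - \<rho>) c\<close>, the excess of \<open>a\<close> over \<open>c\<close> shrinks at least
  geometrically.\<close>

lemma perturbed_contraction_tendsto_0:
  fixes a \<epsilon> :: "nat \<Rightarrow> real"
  assumes \<rho>: "0 \<le> \<rho>" "\<rho> < 1" and a_nonneg: "\<And>n. 0 \<le> a n"
    and step: "\<And>n. a (Suc n) \<le> \<rho> * a n + \<epsilon> n" and eps: "\<epsilon> \<longlonglongrightarrow> 0"
  shows "a \<longlonglongrightarrow> 0"
proof (rule tendstoI)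
  fix e :: real
  assume "e > 0"
  then have pos: "(1 - \<rho>) * (e / 2) > 0"
    using \<rho> by simp
  from tendstoD[OF eps this]
  obtain N where N: "\<And>n. n \<ge> N \<Longrightarrow> \<epsilon> n < (1 - \<rho>) * (e / 2)"
    by (force simp: eventually_sequentially)
  have bound: "a (j + N) - e / 2 \<le> \<rho> ^ j * a N" for j
  proof (induction j)
    case 0
    then show ?case
      using \<open>e > 0\<close> by simp
  next
    case (Suc j)
    have "a (Suc j + N) - e / 2 \<le> \<rho> * (a (j + N) - e / 2)"
      using step[of "j + N"] N[of "j + N"] by (simp add: field_simps)
    also have "\<dots> \<le> \<rho> * (\<rho> ^ j * a N)"
      using Suc \<rho> by (intro mult_left_mono)
    finally show ?case
      by simp
  qed
  have "(\<lambda>j. \<rho> ^ j * a N) \<longlonglongrightarrow> 0 * a N"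
    using \<rho> by (intro tendsto_intros LIMSEQ_power_zero) simp
  then have "\<forall>\<^sub>F j in sequentially. \<rho> ^ j * a N < e / 2"
    using \<open>e > 0\<close> by (intro order_tendstoD(2)[of _ 0]) auto
  then have "\<forall>\<^sub>F j in sequentially. dist (a (j + N)) 0 < e"
  proof eventually_elim
    case (elim j)
    with bound[of j] a_nonneg[of "j + N"] show ?case
      by simp
  qed
  then show "\<forall>\<^sub>F n in sequentially. dist (a n) 0 < e"
    by (rule eventually_sequentially_seg[THEN iffD1])
qed

theorem theoremV1:
  fixes L \<alpha> \<beta> \<delta> lam \<rho> D2 :: real
    and xstar :: "real \<Rightarrow> real^'n"
    and Q :: "real^'n^'n"
    and y :: "nat \<Rightarrow> real \<Rightarrow> real^'n"
    and S :: "(real \<Rightarrow> real^'n) set"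
  assumes "L > 0" and "\<alpha> > 0" and "0 < \<beta>" and "\<beta> < 1"
    and "C1_on_interval L xstar"
    and "positive_definite Q" and "\<delta> > 0" and "loewner_ge Q (\<delta> *\<^sub>R mat 1)"
    and "lam > 0" and "0 < \<rho>" and "\<rho> < 1"
    and contraction: "\<forall>k\<ge>1. \<forall>u\<in>Cspace L. \<forall>v\<in>Cspace L.
          lambda_norm L lam (\<lambda>t. T L \<alpha> \<beta> Q k u t - T L \<alpha> \<beta> Q k v t)
            \<le> \<rho> * lambda_norm L lam (\<lambda>t. u t - v t)"
    and y1_space: "y 1 \<in> Cspace L"
    and y1_eq: "\<forall>t\<in>{0..L}. y 1 t = - xstar t - gain \<alpha> \<beta> Q 1 *v integral {0..t} (y 1)"
    and y_rec: "\<forall>k\<ge>2. y k = (\<lambda>t\<in>{0..L}. T L \<alpha> \<beta> Q k (y (k - 1)) t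
                    + T L \<alpha> \<beta> Q k (\<lambda>s. - ((\<beta> / (1 - \<beta>)) *\<^sub>R xstar s)) t)"
    and D2: "D2 \<ge> max (lambda_norm L lam (y 1))
                      (\<beta> * \<rho> / ((1 - \<beta>) * (1 - \<rho>)) * lambda_norm L lam xstar)"
    and S: "S = {z \<in> Cspace L. lambda_norm L lam z \<le> D2}"
  shows "\<exists>yinf.
           (yinf \<in> S \<and> yinf = T_inf L \<alpha> \<beta> Q (\<lambda>s. yinf s - (\<beta> / (1 - \<beta>)) *\<^sub>R xstar s)) \<and>
           (\<forall>z. z \<in> S \<and> z = T_inf L \<alpha> \<beta> Q (\<lambda>s. z s - (\<beta> / (1 - \<beta>)) *\<^sub>R xstar s) \<longrightarrow> z = yinf) \<and>
           (\<lambda>k. lambda_norm L lam (\<lambda>t. y k t - yinf t)) \<longlonglongrightarrow> 0"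
proof -
  note bds = \<open>L > 0\<close> \<open>lam > 0\<close> \<open>0 < \<rho>\<close> \<open>\<rho> < 1\<close>
  have L: "0 \<le> L" and lam: "0 \<le> lam"
    using bds by auto
  define b where "b = \<beta> / (1 - \<beta>)"
  have b: "0 \<le> b"
    using \<open>0 < \<beta>\<close> \<open>\<beta> < 1\<close> by (simp add: b_def)
  have xstar: "continuous_on {0..L} xstar"
    using \<open>C1_on_interval L xstar\<close> unfolding C1_on_interval_def
    by (meson continuous_on_eq_continuous_within has_vector_derivative_continuous)
  have CspaceD: "continuous_on {0..L} u" if "u \<in> Cspace L" for u :: "real \<Rightarrow> real^'n"
    using that by (simp add: Cspace_def)
  have shift: "continuous_on {0..L} (\<lambda>s. u s - b *\<^sub>R xstar s)"
    if "continuous_on {0..L} u" for u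
    by (intro continuous_intros that xstar)

  have T_cont: "continuous_on {0..L} (T L \<alpha> \<beta> Q k u)" if "continuous_on {0..L} u" for k u
    unfolding T_def by (intro CspaceD T_gain_in_Cspace that)
  have Tinf_Cspace: "T_inf L \<alpha> \<beta> Q u \<in> Cspace L" if "continuous_on {0..L} u" for u
    unfolding T_inf_def by (rule T_gain_in_Cspace[OF that])
  note Tinf_cont = CspaceD[OF Tinf_Cspace]

  have gain_lim: "gain \<alpha> \<beta> Q \<longlonglongrightarrow> gain_inf \<alpha> \<beta> Q"
  proof -
    have "(\<lambda>k. (\<alpha> * ((1 - (1 - \<beta>) ^ k) / \<beta>) / 2) *\<^sub>R Q) \<longlonglongrightarrow> (\<alpha> * ((1 - 0) / \<beta>) / 2) *\<^sub>R Q"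
      using \<open>0 < \<beta>\<close> \<open>\<beta> < 1\<close> by (intro tendsto_intros LIMSEQ_power_zero) auto
    then show ?thesis
      by (simp add: gain_def[abs_def] gain_coeff_def gain_inf_def mult.commute)
  qed
  have T_lim: "(\<lambda>k. lambda_norm L lam (\<lambda>t. T L \<alpha> \<beta> Q k u t - T_inf L \<alpha> \<beta> Q u t)) \<longlonglongrightarrow> 0"
    if "continuous_on {0..L} u" for u
    using lambda_norm_tendsto_0[OF uniform_limit_T_gain[OF gain_lim that, of \<beta>] L lam] T_cont[OF that]
    by (simp add: T_def T_inf_def)

  \<comment> \<open>The hypothesis speaks of elements that are \<open>undefined\<close> outside \<open>[0,L]\<close>;
    \<open>T\<^sub>k\<close> and the norm only see the values on \<open>[0,L]\<close>.\<close>
  have T_contr: "lambda_norm L lam (\<lambda>t. T L \<alpha> \<beta> Q k u t - T L \<alpha> \<beta> Q k v t)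
      \<le> \<rho> * lambda_norm L lam (\<lambda>t. u t - v t)"
    if "k \<ge> 1" and u: "continuous_on {0..L} u" and v: "continuous_on {0..L} v" for k u v
  proof -
    have T_restr: "T L \<alpha> \<beta> Q k (restrict w {0..L}) = T L \<alpha> \<beta> Q k w" for w
      unfolding T_def by (rule T_gain_cong) simp
    have "lambda_norm L lam (\<lambda>t. restrict u {0..L} t - restrict v {0..L} t)
        = lambda_norm L lam (\<lambda>t. u t - v t)"
      by (rule lambda_norm_cong) simp
    then show ?thesis
      using contraction[rule_format, OF \<open>k \<ge> 1\<close> restrict_in_Cspace[OF u] restrict_in_Cspace[OF v]] by (simp only: T_restr)
  qed

  \<comment> \<open>The constant \<open>\<rho>\<close> is the same for all \<open>k\<close>, so the bound survives the limit.\<close>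
  have Tinf_contr: "lambda_norm L lam (\<lambda>t. T_inf L \<alpha> \<beta> Q u t - T_inf L \<alpha> \<beta> Q v t)
      \<le> \<rho> * lambda_norm L lam (\<lambda>t. u t - v t)" (is "?lhs \<le> ?rhs")
    if u: "continuous_on {0..L} u" and v: "continuous_on {0..L} v" for u v
  proof -
    let ?err = "\<lambda>u k. lambda_norm L lam (\<lambda>t. T L \<alpha> \<beta> Q k u t - T_inf L \<alpha> \<beta> Q u t)"
    have "?lhs \<le> ?err u k + ?rhs + ?err v k" if "k \<ge> 1" for k
      using lambda_norm_diff_triangle[OF L Tinf_cont[OF u] T_cont[OF u] Tinf_cont[OF v], of lam k]
        lambda_norm_diff_triangle[OF L T_cont[OF u] T_cont[OF v] Tinf_cont[OF v], of lam k k]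
        T_contr[OF that u v] lambda_norm_diff_commute[of L lam "T_inf L \<alpha> \<beta> Q u"]
      by simp
    moreover have "(\<lambda>k. ?err u k + ?rhs + ?err v k) \<longlonglongrightarrow> 0 + ?rhs + 0"
      by (intro tendsto_intros T_lim u v)
    ultimately show ?thesis
      by (intro LIMSEQ_le_const[of _ ?rhs]) auto
  qed

  define F where "F u = T_inf L \<alpha> \<beta> Q (\<lambda>s. u s - b *\<^sub>R xstar s)" for u
  have F: "F u \<in> Cspace L" if "u \<in> Cspace L" for u
    unfolding F_def by (intro Tinf_Cspace shift CspaceD that)
  have F_contr: "lambda_norm L lam (\<lambda>t. F u t - F v t) \<le> \<rho> * lambda_norm L lam (\<lambda>t. u t - v t)"
    if "u \<in> Cspace L" "v \<in> Cspace L" for u v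
    using Tinf_contr[OF shift[OF CspaceD[OF that(1)]] shift[OF CspaceD[OF that(2)]]]
    by (simp add: F_def)
  obtain z where z: "z \<in> Cspace L" and Fz: "F z = z"
    using lambda_contraction_fixed_point[of L lam \<rho> F, OF L lam _ _ F F_contr] bds by auto
  note z_cont = CspaceD[OF z]

  have unique: "v = z" if "v \<in> Cspace L" "F v = v" for v
  proof (rule Cspace_eqI[OF that(1) z lam])
    have "0 \<le> (\<rho> - 1) * lambda_norm L lam (\<lambda>t. v t - z t)"
      using F_contr[OF that(1) z] that(2) Fz by (simp add: algebra_simps)
    then show "lambda_norm L lam (\<lambda>t. v t - z t) \<le> 0"
      using bds by (simp add: zero_le_mult_iff)
  qed

  \<comment> \<open>Comparison with \<open>T\<^sub>\<infinity> 0 = 0\<close> gives \<open>\<parallel>z\<parallel> \<le> \<rho> (\<parallel>z\<parallel> + b \<parallel>x\<^sup>*\<parallel>)\<close>, and solving for \<open>\<parallel>z\<parallel>\<close>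
    produces exactly the constant \<open>D\<^sup>*\<close>.\<close>
  have z_bound: "lambda_norm L lam z \<le> D2"
  proof -
    let ?N = "lambda_norm L lam"
    have "?N z = ?N (\<lambda>t. F z t - T_inf L \<alpha> \<beta> Q (\<lambda>s. 0) t)"
      by (rule lambda_norm_cong) (simp add: Fz T_inf_def T_gain_zero)
    also have "\<dots> \<le> \<rho> * ?N (\<lambda>t. z t - b *\<^sub>R xstar t)"
      using Tinf_contr[OF shift[OF z_cont], of "\<lambda>s. 0"] by (simp add: F_def)
    also have "\<dots> \<le> \<rho> * (?N z + b * ?N xstar)"
    proof (rule mult_left_mono)
      have "?N (\<lambda>t. z t - b *\<^sub>R xstar t) \<le> ?N z + ?N (\<lambda>t. b *\<^sub>R xstar t)"
        using lambda_norm_diff_triangle[OF L z_cont, of "\<lambda>t. 0" "\<lambda>t. b *\<^sub>R xstar t" lam]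
          lambda_norm_diff_commute[of L lam "\<lambda>t. 0" "\<lambda>t. b *\<^sub>R xstar t"]
        by (simp add: continuous_intros xstar)
      then show "?N (\<lambda>t. z t - b *\<^sub>R xstar t) \<le> ?N z + b * ?N xstar"
        using lambda_norm_scaleR_le[OF L xstar b, of lam] by simp
    qed (use bds in simp)
    finally have "?N z \<le> b * \<rho> / (1 - \<rho>) * ?N xstar"
      using bds by (simp add: field_simps)
    also have "\<dots> = \<beta> * \<rho> / ((1 - \<beta>) * (1 - \<rho>)) * ?N xstar"
      by (simp add: b_def)
    also have "\<dots> \<le> D2"
      using D2 by simp
    finally show ?thesis .
  qed

  have y: "y k \<in> Cspace L \<and> y (Suc k) = T L \<alpha> \<beta> Q (Suc k) (\<lambda>s. y k s - b *\<^sub>R xstar s)"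
    if "k \<ge> 1" for k
  proof -
    \<comment> \<open>Additivity of \<open>T\<^sub>k\<close> merges the two terms of the recursion into one.\<close>
    have rec: "y (Suc j) = T L \<alpha> \<beta> Q (Suc j) (\<lambda>s. y j s - b *\<^sub>R xstar s)"
      if "j \<ge> 1" "y j \<in> Cspace L" for j
    proof -
      have neg: "continuous_on {0..L} (\<lambda>s. - (b *\<^sub>R xstar s))"
        by (intro continuous_intros xstar)
      have "T L \<alpha> \<beta> Q (Suc j) (\<lambda>s. y j s - b *\<^sub>R xstar s) t
          = T L \<alpha> \<beta> Q (Suc j) (y j) t + T L \<alpha> \<beta> Q (Suc j) (\<lambda>s. - (b *\<^sub>R xstar s)) t"
        if "t \<in> {0..L}" for t
        using T_gain_add[OF CspaceD[OF \<open>y j \<in> Cspace L\<close>] neg that] by (simp add: T_def)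
      moreover have "T L \<alpha> \<beta> Q (Suc j) (\<lambda>s. y j s - b *\<^sub>R xstar s) \<in> extensional {0..L}"
        by (simp add: T_def T_gain_def)
      ultimately show ?thesis
        using y_rec[rule_format, of "Suc j"] \<open>j \<ge> 1\<close>
        by (intro extensionalityI[of _ "{0..L}"]) (auto simp: b_def)
    qed
    have "y k \<in> Cspace L"
      using that
    proof (induction k rule: dec_induct)
      case (step j)
      then have "y (Suc j) = T L \<alpha> \<beta> Q (Suc j) (\<lambda>s. y j s - b *\<^sub>R xstar s)"
        by (intro rec)
      then show ?case
        unfolding T_def by (metis T_gain_in_Cspace shift CspaceD step.IH)
    qed (rule y1_space)
    with rec[OF that] show ?thesis
      by blast
  qed

  \<comment> \<open>The index is shifted by one because the sequence starts at \<open>y\<^sub>1\<close>; \<open>y 0\<close> is arbitrary.\<close>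
  define a where "a n = lambda_norm L lam (\<lambda>t. y (Suc n) t - z t)" for n
  let ?x = "\<lambda>s. z s - b *\<^sub>R xstar s"
  define \<epsilon> where "\<epsilon> n = lambda_norm L lam
      (\<lambda>t. T L \<alpha> \<beta> Q (Suc (Suc n)) ?x t - T_inf L \<alpha> \<beta> Q ?x t)" for n
  have y_cont: "continuous_on {0..L} (y (Suc n))" for n
    using y[of "Suc n"] CspaceD by simp
  have "a \<longlonglongrightarrow> 0"
  proof (rule perturbed_contraction_tendsto_0[of \<rho> a \<epsilon>])
    show "0 \<le> a n" for n
      unfolding a_def by (intro lambda_norm_nonneg L continuous_intros y_cont z_cont)
    show "a (Suc n) \<le> \<rho> * a n + \<epsilon> n" for n
    proof -
      have "a (Suc n) \<le> lambda_norm L lam (\<lambda>t. y (Suc (Suc n)) t - T L \<alpha> \<beta> Q (Suc (Suc n)) ?x t)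
          + lambda_norm L lam (\<lambda>t. T L \<alpha> \<beta> Q (Suc (Suc n)) ?x t - z t)"
        unfolding a_def
        by (intro lambda_norm_diff_triangle L y_cont z_cont T_cont shift)
      moreover have "lambda_norm L lam (\<lambda>t. y (Suc (Suc n)) t - T L \<alpha> \<beta> Q (Suc (Suc n)) ?x t)
          \<le> \<rho> * a n"
        using T_contr[OF _ shift[OF y_cont] shift[OF z_cont], of "Suc (Suc n)" n] y[of "Suc n"]
        by (simp add: a_def)
      moreover have "T_inf L \<alpha> \<beta> Q ?x = z"
        using Fz by (simp add: F_def)
      ultimately show ?thesis
        by (simp add: \<epsilon>_def)
    qed
    show "\<epsilon> \<longlonglongrightarrow> 0"
      using T_lim[OF shift[OF z_cont], THEN LIMSEQ_Suc, THEN LIMSEQ_Suc] by (simp add: \<epsilon>_def[abs_def])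
  qed (use bds in auto)
  then have "(\<lambda>k. lambda_norm L lam (\<lambda>t. y k t - z t)) \<longlonglongrightarrow> 0"
    unfolding a_def by (rule LIMSEQ_imp_Suc)
  moreover have "z \<in> S"
    using z z_bound by (simp add: S)
  moreover have "v = z" if "v \<in> S" "v = F v" for v
    using unique[of v] that by (simp add: S)
  ultimately have "(z \<in> S \<and> z = F z) \<and> (\<forall>v. v \<in> S \<and> v = F v \<longrightarrow> v = z)
      \<and> (\<lambda>k. lambda_norm L lam (\<lambda>t. y k t - z t)) \<longlonglongrightarrow> 0"
    using Fz[symmetric] by blast
  then show ?thesis
    unfolding F_def b_def by (intro exI[of _ z])
qed

end
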